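(* Let $S$ be a groupoid. The following statements are equivalent: (1) $S$ is a completely inverse AG**-groupoid; (2) $S$ is a strongly regular AG-groupoid and $E(S)$ is a semilattice; (3) $S$ is a strongly regular AG**-groupoid.
   Context: A groupoid is a set with a binary operation. An AG-groupoid is a groupoid satisfying $(xy)z=(zy)x$; an AG**-groupoid is an AG-groupoid that also satisfies $x(yz)=y(xz)$. In a groupoid, $b$ is an inverse of $a$ if $(ab)a=a$ and $(ba)b=b$. A groupoid is completely inverse if every element $a$ has a unique inverse $a^{-1}$ and $aa^{-1}=a^{-1}a$. A groupoid $S$ is strongly regular if for every $a\in S$ there is $x\in S$ with $a=(ax)a$ and $ax=xa$. $E(S)=\{x\in S: xx=x\}$; "$E(S)$ is a semilattice" means that $E(S)$ is closed under the operation of $S$ and is a commutative semigroup of idempotents under it. *)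

theory Defs
  imports Main
begin

locale groupoid =
  fixes S :: "'a set" and mult :: "'a \<Rightarrow> 'a \<Rightarrow> 'a" (infixl \<open>\<cdot>\<close> 70)
  assumes closed: "x \<in> S \<Longrightarrow> y \<in> S \<Longrightarrow> x \<cdot> y \<in> S"
begin

definition is_inverse :: "'a \<Rightarrow> 'a \<Rightarrow> bool" where
  "is_inverse a b \<longleftrightarrow> a \<in> S \<and> b \<in> S \<and> (a \<cdot> b) \<cdot> a = a \<and> (b \<cdot> a) \<cdot> b = b"

definition idempotents :: "'a set" where
  "idempotents = {x \<in> S. x \<cdot> x = x}"

end

locale AG_groupoid = groupoid +
  assumes left_invertive:
    "x \<in> S \<Longrightarrow> y \<in> S \<Longrightarrow> z \<in> S \<Longrightarrow> (x \<cdot> y) \<cdot> z = (z \<cdot> y) \<cdot> x"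

text \<open>AG**-groupoids in the literature.\<close>

locale AGss_groupoid = AG_groupoid +
  assumes left_swap:
    "x \<in> S \<Longrightarrow> y \<in> S \<Longrightarrow> z \<in> S \<Longrightarrow> x \<cdot> (y \<cdot> z) = y \<cdot> (x \<cdot> z)"

locale completely_inverse_groupoid = groupoid +
  assumes unique_inverse: "a \<in> S \<Longrightarrow> \<exists>!b. is_inverse a b"
    and inverse_commutes: "is_inverse a b \<Longrightarrow> a \<cdot> b = b \<cdot> a"

locale strongly_regular_groupoid = groupoid +
  assumes strongly_regular: "a \<in> S \<Longrightarrow> \<exists>x\<in>S. a = (a \<cdot> x) \<cdot> a \<and> a \<cdot> x = x \<cdot> a"

text \<open>The library locale \<open>semilattice\<close> lives on a whole type; this is the version relative
  to a carrier.\<close>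

locale semilattice_on = groupoid +
  assumes assoc: "x \<in> S \<Longrightarrow> y \<in> S \<Longrightarrow> z \<in> S \<Longrightarrow> (x \<cdot> y) \<cdot> z = x \<cdot> (y \<cdot> z)"
    and commute: "x \<in> S \<Longrightarrow> y \<in> S \<Longrightarrow> x \<cdot> y = y \<cdot> x"
    and idem: "x \<in> S \<Longrightarrow> x \<cdot> x = x"

end

theory Submission
  imports Defs
begin

text \<open>
  Strong regularity attaches to every \<open>a\<close> an idempotent \<open>e = a \<cdot> x = x \<cdot> a\<close> with
  \<open>e \<cdot> a = a\<close> (\<open>left_unit\<close>); that \<open>e\<close> is idempotent needs only the left invertive law.
  The medial law \<open>(a \<cdot> b) \<cdot> (c \<cdot> d) = (a \<cdot> c) \<cdot> (b \<cdot> d)\<close> holds in every AG-groupoid, the paramedial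
  law \<open>(a \<cdot> b) \<cdot> (c \<cdot> d) = (d \<cdot> b) \<cdot> (c \<cdot> a)\<close> in every AG**-groupoid.

  From (3) to (2): the medial law closes the idempotents under the operation, and the
  paramedial law makes them commute; the left invertive law
  \<open>(e \<cdot> f) \<cdot> g = (g \<cdot> f) \<cdot> e\<close> then turns into associativity.

  From (2) to (3): an AG-groupoid with a left identity \<open>h\<close> is an AG**-groupoid, because
  \<open>x \<cdot> (y \<cdot> z) = (h \<cdot> x) \<cdot> (y \<cdot> z) = (h \<cdot> y) \<cdot> (x \<cdot> z) = y \<cdot> (x \<cdot> z)\<close>.  A common left identity
  for \<open>x\<close>, \<open>y\<close>, \<open>z\<close> need not exist, but the product \<open>h\<close> of the idempotents attached to
  them is one for \<open>h \<cdot> x\<close>, \<open>h \<cdot> y\<close>, \<open>h \<cdot> z\<close>, and passing to these elements changes neither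
  \<open>x \<cdot> (y \<cdot> z)\<close> nor \<open>y \<cdot> (x \<cdot> z)\<close>.

  From (3) to (1): the strong-regularity witness \<open>x\<close> of \<open>a\<close> yields the inverse
  \<open>(a \<cdot> x) \<cdot> x\<close>.  The main point is that every inverse \<open>b\<close> of \<open>a\<close> commutes with \<open>a\<close>
  (\<open>inverse_product_idempotent\<close>).  Then \<open>a \<cdot> b\<close> is an idempotent that does not depend on the
  choice of \<open>b\<close>, and uniqueness follows.  From (1) to (3), the inverse is the required
  witness.
\<close>

section \<open>Consequences of the left invertive law\<close>

context AG_groupoid
begin

lemma medial:
  assumes "a \<in> S" "b \<in> S" "c \<in> S" "d \<in> S"
  shows "(a \<cdot> b) \<cdot> (c \<cdot> d) = (a \<cdot> c) \<cdot> (b \<cdot> d)"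
proof -
  have "(a \<cdot> b) \<cdot> (c \<cdot> d) = ((c \<cdot> d) \<cdot> b) \<cdot> a"
    using assms by (intro left_invertive closed)
  also have "\<dots> = ((b \<cdot> d) \<cdot> c) \<cdot> a"
    using assms by (simp add: left_invertive[of c d b])
  also have "\<dots> = (a \<cdot> c) \<cdot> (b \<cdot> d)"
    using assms by (intro left_invertive closed)
  finally show ?thesis .
qed

lemma mult_idempotent:
  assumes "e \<in> idempotents" "f \<in> idempotents"
  shows "e \<cdot> f \<in> idempotents"
  using assms medial[of e f e f] by (auto simp: idempotents_def closed)

text \<open>Multiplication by an idempotent is an endomorphism: this is the medial law with
  \<open>h = h \<cdot> h\<close>.\<close>

lemma idempotent_mult_distrib:
  assumes "h \<in> idempotents" "x \<in> S" "y \<in> S"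
  shows "h \<cdot> (x \<cdot> y) = (h \<cdot> x) \<cdot> (h \<cdot> y)"
  using assms medial[of h h x y] by (simp add: idempotents_def)

lemma commuting_regular_idempotent:
  assumes "a \<in> S" "x \<in> S" "(a \<cdot> x) \<cdot> a = a" "a \<cdot> x = x \<cdot> a"
  shows "a \<cdot> x \<in> idempotents"
proof -
  have "a \<cdot> x = ((a \<cdot> x) \<cdot> a) \<cdot> x"
    using assms by simp
  also have "\<dots> = (x \<cdot> a) \<cdot> (a \<cdot> x)"
    using assms by (intro left_invertive closed)
  finally show ?thesis
    using assms by (simp add: idempotents_def closed)
qed

text \<open>This is the source of the AG**-law: a common left identity moves \<open>y\<close> past \<open>x\<close> by
  the medial law.\<close>

lemma left_swap_if_left_identity:
  assumes "h \<in> S" "x \<in> S" "y \<in> S" "z \<in> S" "h \<cdot> x = x" "h \<cdot> y = y"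
  shows "x \<cdot> (y \<cdot> z) = y \<cdot> (x \<cdot> z)"
  using assms medial[of h x y z] by simp

end

locale strongly_regular_AG_groupoid = strongly_regular_groupoid + AG_groupoid
begin

lemma left_unit:
  assumes "a \<in> S"
  obtains e x where "e \<in> idempotents" "x \<in> S" "a \<cdot> x = e" "x \<cdot> a = e" "e \<cdot> a = a"
proof -
  obtain x where "x \<in> S" "a = (a \<cdot> x) \<cdot> a" "a \<cdot> x = x \<cdot> a"
    using strongly_regular[OF assms] by blast
  then show thesis
    using that[of "a \<cdot> x" x] commuting_regular_idempotent[of a x] assms by metis
qed

section \<open>A semilattice of idempotents yields the AG**-law\<close>

text \<open>The left swap law is carried from \<open>h \<cdot> x\<close>, \<open>h \<cdot> y\<close>, \<open>h \<cdot> z\<close>, where \<open>h\<close> is a left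
  identity, back to \<open>x\<close>, \<open>y\<close>, \<open>z\<close>.\<close>

lemma left_swap_if_idempotents_semilattice:
  assumes sl: "semilattice_on idempotents (\<cdot>)"
    and S: "x \<in> S" "y \<in> S" "z \<in> S"
  shows "x \<cdot> (y \<cdot> z) = y \<cdot> (x \<cdot> z)"
proof -
  interpret E: semilattice_on idempotents "(\<cdot>)" by (fact sl)
  obtain e where e: "e \<in> idempotents" "e \<cdot> x = x" using left_unit[OF S(1)] by metis
  obtain f where f: "f \<in> idempotents" "f \<cdot> y = y" using left_unit[OF S(2)] by metis
  obtain g where g: "g \<in> idempotents" "g \<cdot> z = z" using left_unit[OF S(3)] by metis
  define h where "h = e \<cdot> (f \<cdot> g)"
  have h: "h \<in> idempotents"
    unfolding h_def using e f g by (intro E.closed)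
  have inS: "e \<in> S" "f \<in> S" "g \<in> S" "h \<in> S"
    using e f g h by (auto simp: idempotents_def)
  have h': "h = f \<cdot> (e \<cdot> g)"
    unfolding h_def using e f g by (metis E.assoc E.commute)
  have he: "h \<cdot> e = h"
    unfolding h_def using e f g by (metis E.assoc E.commute E.idem E.closed)
  have hf: "h \<cdot> f = h"
    unfolding h' using e f g by (metis E.assoc E.commute E.idem E.closed)
  have absorb: "h \<cdot> (h \<cdot> u) = h \<cdot> u"
    if "u \<in> S" "k \<in> S" "k \<cdot> u = u" "h \<cdot> k = h" for k u
    using idempotent_mult_distrib[OF h, of k u] that by simp
  \<comment> \<open>Since \<open>x = e \<cdot> x\<close>, \<open>y = f \<cdot> y\<close>, \<open>z = g \<cdot> z\<close>, the medial law collects \<open>e\<close>, \<open>f\<close>, \<open>g\<close>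
      in front of the product.\<close>
  have "h \<cdot> (x \<cdot> (y \<cdot> z)) = x \<cdot> (y \<cdot> z)"
    unfolding h_def
    using medial[of e "f \<cdot> g" x "y \<cdot> z"] medial[of f g y z] e f g S inS
    by (simp add: closed)
  then have "x \<cdot> (y \<cdot> z) = (h \<cdot> x) \<cdot> ((h \<cdot> y) \<cdot> (h \<cdot> z))"
    using idempotent_mult_distrib[OF h] S by (simp add: closed)
  also have "\<dots> = (h \<cdot> y) \<cdot> ((h \<cdot> x) \<cdot> (h \<cdot> z))"
    using left_swap_if_left_identity[of h "h \<cdot> x" "h \<cdot> y" "h \<cdot> z"]
      absorb[of x e] absorb[of y f] e f he hf S inS
    by (simp add: closed)
  also have "\<dots> = h \<cdot> (y \<cdot> (x \<cdot> z))"
    using idempotent_mult_distrib[OF h] S by (simp add: closed)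
  also have "\<dots> = y \<cdot> (x \<cdot> z)"
    unfolding h'
    using medial[of f "e \<cdot> g" y "x \<cdot> z"] medial[of e g x z] e f g S inS
    by (simp add: closed)
  finally show ?thesis .
qed

end

section \<open>Idempotents of an AG**-groupoid\<close>

context AGss_groupoid
begin

lemma paramedial:
  assumes "a \<in> S" "b \<in> S" "c \<in> S" "d \<in> S"
  shows "(a \<cdot> b) \<cdot> (c \<cdot> d) = (d \<cdot> b) \<cdot> (c \<cdot> a)"
proof -
  have "(a \<cdot> b) \<cdot> (c \<cdot> d) = c \<cdot> ((a \<cdot> b) \<cdot> d)"
    using assms by (intro left_swap closed)
  also have "\<dots> = c \<cdot> ((d \<cdot> b) \<cdot> a)"
    using assms by (simp add: left_invertive[of a b d])
  also have "\<dots> = (d \<cdot> b) \<cdot> (c \<cdot> a)"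
    using assms by (intro left_swap closed)
  finally show ?thesis .
qed

lemma square_mult_commute:
  assumes "a \<in> S" "b \<in> S"
  shows "(a \<cdot> b) \<cdot> (a \<cdot> b) = (b \<cdot> a) \<cdot> (b \<cdot> a)"
  using paramedial[of a b a b] medial[of b b a a] assms by simp

lemma idempotents_commute:
  assumes "e \<in> idempotents" "f \<in> idempotents"
  shows "e \<cdot> f = f \<cdot> e"
  using square_mult_commute[of e f] mult_idempotent[of e f] mult_idempotent[of f e] assms
  by (simp add: idempotents_def)

text \<open>Left invertivity reverses the factors of \<open>(e \<cdot> f) \<cdot> g\<close>, and commutativity restores
  their order with the other bracketing.\<close>

lemma idempotents_semilattice: "semilattice_on idempotents (\<cdot>)"
proof
  fix e f g
  assume E: "e \<in> idempotents" "f \<in> idempotents" "g \<in> idempotents"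
  then have "(e \<cdot> f) \<cdot> g = (g \<cdot> f) \<cdot> e"
    by (simp add: idempotents_def left_invertive)
  also have "\<dots> = e \<cdot> (f \<cdot> g)"
    using E by (metis idempotents_commute mult_idempotent)
  finally show "(e \<cdot> f) \<cdot> g = e \<cdot> (f \<cdot> g)" .
qed (auto simp: mult_idempotent idempotents_commute, simp add: idempotents_def)

end

section \<open>Inverses in a strongly regular AG**-groupoid\<close>

locale strongly_regular_AGss_groupoid = strongly_regular_AG_groupoid + AGss_groupoid
begin

text \<open>The witness \<open>x\<close> of strong regularity need not satisfy \<open>(x \<cdot> a) \<cdot> x = x\<close>.  Multiplying
  it by the idempotent \<open>e = a \<cdot> x\<close> repairs this.\<close>

lemma inverse_exists:
  assumes a: "a \<in> S"
  shows "\<exists>b. is_inverse a b"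
proof -
  obtain e x where ex: "e \<in> idempotents" "x \<in> S" "a \<cdot> x = e" "x \<cdot> a = e" "e \<cdot> a = a"
    using left_unit[OF a] .
  then have e: "e \<in> S" "e \<cdot> e = e"
    by (auto simp: idempotents_def)
  have right: "a \<cdot> (e \<cdot> x) = e"
    using left_swap[of a e x] a ex e by simp
  have left: "(e \<cdot> x) \<cdot> a = e"
    using left_invertive[of e x a] a ex e by simp
  have "e \<cdot> (e \<cdot> x) = (x \<cdot> a) \<cdot> (e \<cdot> x)"
    using ex by simp
  also have "\<dots> = (x \<cdot> e) \<cdot> (a \<cdot> x)"
    using a ex e by (intro medial)
  also have "\<dots> = (e \<cdot> e) \<cdot> x"
    using left_invertive[of x e e] ex e by simp
  finally have "e \<cdot> (e \<cdot> x) = e \<cdot> x"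
    using e by simp
  then have "is_inverse a (e \<cdot> x)"
    using a ex e left right by (simp add: is_inverse_def closed)
  then show ?thesis by blast
qed

text \<open>Strong regularity allows one factor \<open>p\<close> of \<open>(p \<cdot> p) \<cdot> p = p \<cdot> p\<close> to be cancelled:
  multiplying both sides on the right by the witness \<open>r\<close> of \<open>p\<close> turns the right side into
  \<open>p\<close> and the left side into \<open>p \<cdot> p\<close>.\<close>

lemma idempotent_if_cube_eq_square:
  assumes p: "p \<in> S" and cube: "(p \<cdot> p) \<cdot> p = p \<cdot> p"
  shows "p \<cdot> p = p"
proof -
  obtain g r where g: "g \<in> idempotents" "r \<in> S" "p \<cdot> r = g" "r \<cdot> p = g" "g \<cdot> p = p"
    using left_unit[OF p] .
  then have gS: "g \<in> S"
    by (simp add: idempotents_def)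
  have "p = (p \<cdot> p) \<cdot> r"
    using left_invertive[of p p r] p g by simp
  also have "\<dots> = ((p \<cdot> p) \<cdot> p) \<cdot> r"
    using cube by simp
  also have "\<dots> = (r \<cdot> p) \<cdot> (p \<cdot> p)"
    using p g by (intro left_invertive closed)
  also have "\<dots> = p \<cdot> p"
    using left_swap[of g p p] p g gS by simp
  finally show ?thesis by simp
qed

text \<open>With \<open>p = a \<cdot> b\<close> and \<open>q = b \<cdot> a\<close>, the inverse equations give \<open>q = p \<cdot> q\<close>.  As
  \<open>p \<cdot> p = q \<cdot> q\<close> by paramediality, \<open>p \<cdot> p = (p \<cdot> q) \<cdot> q = (q \<cdot> q) \<cdot> p = (p \<cdot> p) \<cdot> p\<close>, and
  cancellation applies.\<close>

lemma inverse_product_idempotent: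
  assumes "is_inverse a b"
  shows "a \<cdot> b \<in> idempotents"
proof -
  have inv: "a \<in> S" "b \<in> S" "(a \<cdot> b) \<cdot> a = a" "(b \<cdot> a) \<cdot> b = b"
    using assms by (auto simp: is_inverse_def)
  define p q where "p = a \<cdot> b" and "q = b \<cdot> a"
  have pq: "p \<in> S" "q \<in> S"
    using inv by (auto simp: p_def q_def closed)
  have q: "q = p \<cdot> q"
    using left_invertive[of "b \<cdot> a" b a] inv by (simp add: p_def q_def closed)
  have sq: "p \<cdot> p = q \<cdot> q"
    unfolding p_def q_def using inv by (intro square_mult_commute)
  have "(p \<cdot> p) \<cdot> p = (q \<cdot> q) \<cdot> p"
    using sq by simp
  also have "\<dots> = (p \<cdot> q) \<cdot> q"
    using pq by (intro left_invertive)
  also have "\<dots> = p \<cdot> p"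
    using q sq by simp
  finally have "p \<cdot> p = p"
    using idempotent_if_cube_eq_square pq by blast
  then show ?thesis
    using pq by (simp add: idempotents_def p_def)
qed

lemma is_inverse_sym: "is_inverse a b \<Longrightarrow> is_inverse b a"
  by (auto simp: is_inverse_def)

lemma inverse_commute:
  assumes "is_inverse a b"
  shows "a \<cdot> b = b \<cdot> a"
  using square_mult_commute[of a b] inverse_product_idempotent[OF assms]
    inverse_product_idempotent[OF is_inverse_sym[OF assms]] assms
  by (simp add: is_inverse_def idempotents_def)

text \<open>Each of the idempotents \<open>a \<cdot> b\<close> and \<open>a \<cdot> c\<close> fixes \<open>a\<close> from the left, so each absorbs
  the other.\<close>

lemma inverse_product_unique:
  assumes b: "is_inverse a b" and c: "is_inverse a c"
  shows "a \<cdot> b = a \<cdot> c"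
proof -
  have absorb: "a \<cdot> u = (a \<cdot> u) \<cdot> (a \<cdot> v)" if "is_inverse a u" "is_inverse a v" for u v
  proof -
    have uv: "a \<in> S" "u \<in> S" "v \<in> S" "(a \<cdot> v) \<cdot> a = a"
      using that by (auto simp: is_inverse_def)
    have "a \<cdot> u = ((a \<cdot> v) \<cdot> a) \<cdot> u"
      using uv by simp
    also have "\<dots> = (u \<cdot> a) \<cdot> (a \<cdot> v)"
      using uv by (intro left_invertive closed)
    finally show ?thesis
      using inverse_commute[OF that(1)] by simp
  qed
  show ?thesis
    using absorb[OF b c] absorb[OF c b] idempotents_commute
      inverse_product_idempotent[OF b] inverse_product_idempotent[OF c]
    by simp
qed

lemma inverse_unique:
  assumes b: "is_inverse a b" and c: "is_inverse a c"
  shows "b = c"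
proof -
  have S: "a \<in> S" "b \<in> S" "c \<in> S" and inv: "(b \<cdot> a) \<cdot> b = b" "(c \<cdot> a) \<cdot> c = c"
    using b c by (auto simp: is_inverse_def)
  have eq: "b \<cdot> a = c \<cdot> a"
    using inverse_product_unique[OF b c] inverse_commute[OF b] inverse_commute[OF c] by simp
  have "b = (c \<cdot> a) \<cdot> b"
    using inv eq by simp
  also have "\<dots> = (b \<cdot> a) \<cdot> c"
    using S by (intro left_invertive)
  also have "\<dots> = c"
    using inv eq by simp
  finally show ?thesis .
qed

lemma completely_inverse: "completely_inverse_groupoid S (\<cdot>)"
proof
  show "\<exists>!b. is_inverse a b" if "a \<in> S" for a
    using inverse_exists[OF that] inverse_unique by blast
qed (rule inverse_commute)

end

section \<open>The equivalence\<close>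

lemma (in completely_inverse_groupoid) strongly_regular_groupoid:
  "strongly_regular_groupoid S (\<cdot>)"
proof
  fix a assume "a \<in> S"
  then obtain b where "is_inverse a b"
    using unique_inverse by blast
  then show "\<exists>x\<in>S. a = (a \<cdot> x) \<cdot> a \<and> a \<cdot> x = x \<cdot> a"
    using inverse_commutes[of a b] by (metis is_inverse_def)
qed

theorem theorem3:
  fixes S :: "'a set" and mult :: "'a \<Rightarrow> 'a \<Rightarrow> 'a"
  assumes "groupoid S mult"
  shows "(completely_inverse_groupoid S mult \<and> AGss_groupoid S mult
            \<longleftrightarrow> strongly_regular_groupoid S mult \<and> AG_groupoid S mult
                  \<and> semilattice_on (groupoid.idempotents S mult) mult)
       \<and> (strongly_regular_groupoid S mult \<and> AG_groupoid S mult
                  \<and> semilattice_on (groupoid.idempotents S mult) mult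
            \<longleftrightarrow> strongly_regular_groupoid S mult \<and> AGss_groupoid S mult)"
    (is "(?ci \<and> ?AGss \<longleftrightarrow> ?sr \<and> ?AG \<and> ?sl) \<and> _")
proof -
  have regular: ?sr if ?ci
    using that by (rule completely_inverse_groupoid.strongly_regular_groupoid)
  have inverse: ?ci if ?sr ?AGss
    using that
    by (intro strongly_regular_AGss_groupoid.completely_inverse
        strongly_regular_AGss_groupoid.intro strongly_regular_AG_groupoid.intro)
      (auto simp: AGss_groupoid_def)
  have semilattice: "?AG \<and> ?sl" if ?AGss
    using that AGss_groupoid.idempotents_semilattice by (auto simp: AGss_groupoid_def)
  have swap: ?AGss if ?sr ?AG ?sl
  proof -
    interpret strongly_regular_AG_groupoid S mult
      using that(1,2) by (rule strongly_regular_AG_groupoid.intro)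
    show ?thesis
      using left_swap_if_idempotents_semilattice[OF that(3)] by unfold_locales
  qed
  show ?thesis
    using regular inverse semilattice swap by blast
qed

end
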